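(* Let $H$ be a real Hilbert space, $C\subseteq H$ a nonempty bounded closed convex set with $\operatorname{diam}(C)\le M$, where $M$ is a positive integer, let $T:C\to C$ be a demicontinuous (single-valued) pseudocontraction, and let $x_1,z\in C$. Let $(\lambda_n)_{n\in\mathbb{N}}$, $(\theta_n)_{n\in\mathbb{N}}$ be sequences in $[0,1]$ which are acceptably paired with moduli $\varphi_1,\varphi_2,\varphi_3,f,n_0,\delta$ and satisfy $\lambda_n(1+\theta_n)\le 1$ for all $n$. Let $(y_i)_{i\in\mathbb{N}}$ be a sequence in $C$ with $$y_i=\frac{1}{1+\theta_i}Ty_i+\frac{\theta_i}{1+\theta_i}z\quad\text{for all } i,$$ and suppose $(y_i)$ is metastable with rate $\Psi:(0,\infty)\times\mathbb{N}^{\mathbb{N}}\to\mathbb{N}$. Define $(x_n)_{n\ge1}$ by $$x_{n+1}=(1-\lambda_n)x_n+\lambda_nTx_n+\lambda_n\theta_n(z-x_n).$$ For $\varepsilon>0$ and $g:\mathbb{N}\to\mathbb{N}$ define $c:=\exp(-\delta/2)$, $\tilde\varepsilon:=\frac{1-c}{16}\varepsilon$, $k_0:=\max\{\varphi_2(\varepsilon^2/6M^2),\varphi_3(\varepsilon^2/12M^2)\}$, $d:=\max\{f(k_0),\lceil\log_c(\varepsilon/8M)\rceil\}$, $n_1:=\max\{n_0,\varphi_1(\delta/2),\varphi_2(\tilde\varepsilon^2/4M^2),\varphi_3(\tilde\varepsilon^2/8M^2)\}$, $\tilde g(n):=\bigl(f(n)+g(f(n))\bigr)^*-n$, $g_d(n):=d+n_1+1+\tilde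 g(n+n_1+d+1)$, $(g_d)_f(n):=f(n+g_d(n))-n$, and $$\Phi(\varepsilon,g):=f\bigl(\Psi(\tilde\varepsilon,(g_d)_f)+n_1+d+1\bigr).$$ Then for all $\varepsilon>0$ and all $g:\mathbb{N}\to\mathbb{N}$ there exists $n\le\Phi(\varepsilon,g)$ such that for all $i,j\in[n;n+g(n)]$, $$\|x_i-y_{f(i^* )}\|\le\varepsilon\quad\text{and}\quad\|y_{f(i^* )}-y_{f(j^* )}\|\le\varepsilon.$$
   Context: For $n,m\in\mathbb{N}$, $[n;n+m]:=\{n,n+1,\dots,n+m\}$. $T:C\to C$ is a pseudocontraction if $\langle Tu-Tv,u-v\rangle\le\|u-v\|^2$ for all $u,v\in C$; it is demicontinuous if it is continuous from the norm topology to the weak topology. A sequence $(a_n)$ is metastable with rate $\Psi:(0,\infty)\times\mathbb{N}^{\mathbb{N}}\to\mathbb{N}$ if for all $\varepsilon>0$ and all $g:\mathbb{N}\to\mathbb{N}$ there is $n\le\Psi(\varepsilon,g)$ with $\|a_i-a_j\|\le\varepsilon$ for all $i,j\in[n;n+g(n)]$. Two sequences $(\lambda_n),(\theta_n)$ in $[0,1]$ are acceptably paired with moduli $\varphi_1,\varphi_2,\varphi_3:(0,\infty)\to\mathbb{N}$, $f:\mathbb{N}\to\mathbb{N}$, $n_0\in\mathbb{N}$ and $\delta>0$ if $(\theta_n)$ is nonincreasing and: (i) $\theta_n\le\varepsilon$ for all $\varepsilon>0$ and $n\ge\varphi_1(\varepsilon)$; (ii) $f(n+1)\ge f(n)+1$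 for all $n$; (iii) $\theta_{f(n)}\sum_{j=f(n)}^{f(n+1)}\lambda_j\ge\delta$ for all $n\ge n_0$; (iv) $(\theta_{f(n)}-\theta_{f(n+1)})\sum_{j=f(n)}^{f(n+1)}\lambda_j\le\varepsilon$ for all $\varepsilon>0$ and $n\ge\varphi_2(\varepsilon)$; (v) $\sum_{j=f(n)}^{f(n+1)}\lambda_j^2\le\varepsilon$ for all $\varepsilon>0$ and $n\ge\varphi_3(\varepsilon)$. For $k\ge f(0)$, $k^*:=\max\{n\in\mathbb{N}:f(n)\le k\}$. *)

theory Defs
  imports "HOL-Analysis.Analysis"
begin

definition pseudocontraction_on :: "'a::real_inner set \<Rightarrow> ('a \<Rightarrow> 'a) \<Rightarrow> bool" where
  "pseudocontraction_on C T \<longleftrightarrow>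
     (\<forall>u\<in>C. \<forall>v\<in>C. inner (T u - T v) (u - v) \<le> (norm (u - v))\<^sup>2)"

text \<open>The coarsest topology making every bounded linear functional continuous.\<close>

definition weak_topology :: "'a::real_normed_vector topology" where
  "weak_topology =
     topology_generated_by {\<phi> -` U | (\<phi> :: 'a \<Rightarrow> real) U. bounded_linear \<phi> \<and> open U}"

definition demicontinuous_on :: "'a::real_normed_vector set \<Rightarrow> ('a \<Rightarrow> 'a) \<Rightarrow> bool" where
  "demicontinuous_on C T \<longleftrightarrow> continuous_map (top_of_set C) weak_topology T"

definition metastable_with_rate ::
    "(nat \<Rightarrow> 'a::real_normed_vector) \<Rightarrow> (real \<Rightarrow> (nat \<Rightarrow> nat) \<Rightarrow> nat) \<Rightarrow> bool" where
  "metastable_with_rate a \<Psi> \<longleftrightarrow>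
     (\<forall>\<epsilon>>0. \<forall>g. \<exists>n\<le>\<Psi> \<epsilon> g. \<forall>i\<in>{n..n + g n}. \<forall>j\<in>{n..n + g n}. norm (a i - a j) \<le> \<epsilon>)"

definition acceptably_paired ::
    "(nat \<Rightarrow> real) \<Rightarrow> (nat \<Rightarrow> real) \<Rightarrow> (real \<Rightarrow> nat) \<Rightarrow> (real \<Rightarrow> nat) \<Rightarrow> (real \<Rightarrow> nat) \<Rightarrow>
     (nat \<Rightarrow> nat) \<Rightarrow> nat \<Rightarrow> real \<Rightarrow> bool" where
  "acceptably_paired lam \<theta> \<phi>1 \<phi>2 \<phi>3 f n0 \<delta> \<longleftrightarrow>
     (\<forall>n. lam n \<in> {0..1}) \<and> (\<forall>n. \<theta> n \<in> {0..1}) \<and> \<delta> > 0 \<and> decseq \<theta> \<and>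
     (\<forall>\<epsilon>>0. \<forall>n\<ge>\<phi>1 \<epsilon>. \<theta> n \<le> \<epsilon>) \<and>
     (\<forall>n. f (n + 1) \<ge> f n + 1) \<and>
     (\<forall>n\<ge>n0. \<theta> (f n) * (\<Sum>j = f n..f (n + 1). lam j) \<ge> \<delta>) \<and>
     (\<forall>\<epsilon>>0. \<forall>n\<ge>\<phi>2 \<epsilon>. (\<theta> (f n) - \<theta> (f (n + 1))) * (\<Sum>j = f n..f (n + 1). lam j) \<le> \<epsilon>) \<and>
     (\<forall>\<epsilon>>0. \<forall>n\<ge>\<phi>3 \<epsilon>. (\<Sum>j = f n..f (n + 1). (lam j)\<^sup>2) \<le> \<epsilon>)"

text \<open>The index \<open>k\<^sup>*\<close> relative to \<open>f\<close>; only meaningful for strictly increasing \<open>f\<close> and \<open>k \<ge> f 0\<close>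
  (otherwise the maximum is taken over an infinite or empty set).\<close>

definition star :: "(nat \<Rightarrow> nat) \<Rightarrow> nat \<Rightarrow> nat" where
  "star f k = Max {n. f n \<le> k}"

text \<open>For strictly increasing \<open>f\<close>, none of the subtractions on \<^typ>\<open>nat\<close> below truncates. The logarithm
  may be negative, but then it does not affect the maximum with \<open>f k0\<close>, so applying \<^const>\<open>nat\<close> to
  its ceiling is harmless.\<close>

definition rate_Phi ::
    "(real \<Rightarrow> nat) \<Rightarrow> (real \<Rightarrow> nat) \<Rightarrow> (real \<Rightarrow> nat) \<Rightarrow> (nat \<Rightarrow> nat) \<Rightarrow> nat \<Rightarrow> real \<Rightarrow> nat \<Rightarrow>
     (real \<Rightarrow> (nat \<Rightarrow> nat) \<Rightarrow> nat) \<Rightarrow> real \<Rightarrow> (nat \<Rightarrow> nat) \<Rightarrow> nat" where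
  "rate_Phi \<phi>1 \<phi>2 \<phi>3 f n0 \<delta> M \<Psi> \<epsilon> g =
     (let c = exp (- \<delta> / 2);
          \<epsilon>' = (1 - c) / 16 * \<epsilon>;
          k0 = max (\<phi>2 (\<epsilon>\<^sup>2 / (6 * (real M)\<^sup>2))) (\<phi>3 (\<epsilon>\<^sup>2 / (12 * (real M)\<^sup>2)));
          d = max (f k0) (nat \<lceil>log c (\<epsilon> / (8 * real M))\<rceil>);
          n1 = Max {n0, \<phi>1 (\<delta> / 2), \<phi>2 (\<epsilon>'\<^sup>2 / (4 * (real M)\<^sup>2)), \<phi>3 (\<epsilon>'\<^sup>2 / (8 * (real M)\<^sup>2))};
          g' = (\<lambda>n. star f (f n + g (f n)) - n);
          gd = (\<lambda>n. d + n1 + 1 + g' (n + n1 + d + 1));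
          gdf = (\<lambda>n. f (n + gd n) - n)
      in f (\<Psi> \<epsilon>' gdf + n1 + d + 1))"

end

theory Submission
  imports Defs
begin

text \<open>
  Within a block \<open>f k \<le> j < f (k + 1)\<close> the iterates \<open>x j\<close> are compared with the fixed point
  \<open>y (f k)\<close> of the regularized map at the start of the block. Monotonicity of \<open>I - T\<close> makes
  \<open>\<parallel>x j - y (f k)\<parallel>\<^sup>2\<close> contract by \<open>1 - 2 \<lambda>\<^sub>j \<theta>\<^bsub>f k\<^esub>\<close> in each step, up to an error controlled by
  conditions (iv) and (v), so that by (iii) a whole block contracts the distance by \<open>c = exp (-\<delta>/2)\<close>.
  On a stretch where the \<open>y (f k)\<close> are almost constant, which metastability provides, \<open>d\<close> blocks
  then bring \<open>x (f k)\<close> close to \<open>y (f k)\<close>, and the distance cannot grow much inside a block.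
\<close>

text \<open>Write \<open>u' = u - l *\<^sub>R w\<close> and expand the square. Subtracting the
  equation for \<open>v\<close> from \<open>w\<close> exposes the increment of \<open>I - T\<close>,
  which is monotone because \<open>T\<close> is a pseudocontraction, plus
  \<open>s *\<^sub>R (u - v)\<close>, which yields the contraction. Here \<open>s\<close> is the
  parameter at the block start and \<open>t\<close> the current one; their gap costs
  \<open>2 * B\<^sup>2 * (s - t) * l\<close>, and \<open>norm w \<le> 2 * B\<close> gives the
  quadratic error.\<close>

lemma regularized_step_bound:
  fixes u u' v z :: "'a::real_inner" and l s t B :: real
  assumes pc: "inner (T u - T v) (u - v) \<le> (norm (u - v))\<^sup>2"
    and fp: "(1 + s) *\<^sub>R v = T v + s *\<^sub>R z"
    and u': "u' = (1 - l) *\<^sub>R u + l *\<^sub>R T u + (l * t) *\<^sub>R (z - u)"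
    and l: "0 \<le> l" and t: "0 \<le> t" "t \<le> 1" "t \<le> s"
    and B: "norm (u - T u) \<le> B" "norm (u - z) \<le> B" "norm (u - v) \<le> B"
  shows "(norm (u' - v))\<^sup>2 \<le> (1 - 2 * l * s) * (norm (u - v))\<^sup>2 + (2 * B\<^sup>2 * (s - t) * l + 4 * B\<^sup>2 * l\<^sup>2)"
proof -
  define w where "w = (u - T u) + t *\<^sub>R (u - z)"
  have B0: "0 \<le> B" using B(1) norm_ge_zero order_trans by blast
  have "norm w \<le> norm (u - T u) + t * norm (u - z)"
    unfolding w_def using norm_triangle_ineq[of "u - T u" "t *\<^sub>R (u - z)"] t(1) by simp
  also have "\<dots> \<le> B + 1 * B"
    using B t by (intro add_mono mult_mono) auto
  finally have nw: "(norm w)\<^sup>2 \<le> (2 * B)\<^sup>2"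
    by (intro power_mono) auto
  have "u' - v = (u - v) - l *\<^sub>R w"
    unfolding u' w_def by (simp add: algebra_simps)
  then have sq: "(norm (u' - v))\<^sup>2 = (norm (u - v))\<^sup>2 - 2 * l * inner w (u - v) + l\<^sup>2 * (norm w)\<^sup>2"
    unfolding \<open>u' - v = _\<close> power2_norm_eq_inner
    by (simp add: inner_diff inner_commute power2_eq_square algebra_simps)
  \<comment> \<open>By \<open>fp\<close>, \<open>(v - T v) + s *\<^sub>R (v - z)\<close> vanishes,
    so it may be subtracted from \<open>w\<close>.\<close>
  have "w = (u - v) - (T u - T v) + s *\<^sub>R (u - v) - (s - t) *\<^sub>R (u - z)"
    unfolding w_def using fp by (simp add: algebra_simps)
  then have "inner w (u - v) = ((norm (u - v))\<^sup>2 - inner (T u - T v) (u - v))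
      + s * (norm (u - v))\<^sup>2 - (s - t) * inner (u - z) (u - v)"
    by (simp only: inner_diff_left inner_add_left inner_scaleR_left power2_norm_eq_inner)
  moreover have "(s - t) * inner (u - z) (u - v) \<le> (s - t) * B\<^sup>2"
  proof (rule mult_left_mono)
    have "inner (u - z) (u - v) \<le> norm (u - z) * norm (u - v)" by (rule norm_cauchy_schwarz)
    also have "\<dots> \<le> B * B" using B B0 by (intro mult_mono) auto
    finally show "inner (u - z) (u - v) \<le> B\<^sup>2" by (simp add: power2_eq_square)
  qed (use t in simp)
  ultimately have "s * (norm (u - v))\<^sup>2 - (s - t) * B\<^sup>2 \<le> inner w (u - v)"
    using pc by linarith
  then have "2 * l * (s * (norm (u - v))\<^sup>2 - (s - t) * B\<^sup>2) \<le> 2 * l * inner w (u - v)"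
    using l by (intro mult_left_mono) auto
  moreover have "l\<^sup>2 * (norm w)\<^sup>2 \<le> l\<^sup>2 * (2 * B)\<^sup>2"
    using nw by (intro mult_left_mono) auto
  ultimately show ?thesis
    unfolding sq by (simp add: algebra_simps)
qed

text \<open>A discrete Gronwall estimate: \<open>1 - r \<le> exp (- r)\<close> turns the product of
  the factors into the exponential of a sum, while the errors are simply added up without
  damping.\<close>

lemma contractive_recursion_bound:
  fixes b r e :: "nat \<Rightarrow> real"
  assumes step: "\<And>j. p \<le> j \<Longrightarrow> j < q \<Longrightarrow> b (Suc j) \<le> (1 - r j) * b j + e j"
    and b: "\<And>j. 0 \<le> b j"
    and r: "\<And>j. p \<le> j \<Longrightarrow> j < q \<Longrightarrow> 0 \<le> r j"
    and e: "\<And>j. p \<le> j \<Longrightarrow> j < q \<Longrightarrow> 0 \<le> e j"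
    and "p \<le> q"
  shows "b q \<le> exp (- (\<Sum>j = p..<q. r j)) * b p + (\<Sum>j = p..<q. e j)"
proof -
  have "m \<le> q \<longrightarrow> b m \<le> exp (- (\<Sum>j = p..<m. r j)) * b p + (\<Sum>j = p..<m. e j)" if "p \<le> m" for m
    using that
  proof (induction m rule: dec_induct)
    case base
    then show ?case by simp
  next
    case (step m)
    show ?case
    proof
      assume mq: "Suc m \<le> q"
      let ?E = "exp (- (\<Sum>j = p..<m. r j)) * b p" and ?S = "\<Sum>j = p..<m. e j"
      have S: "0 \<le> ?S" using e mq by (intro sum_nonneg) auto
      have "b (Suc m) \<le> (1 - r m) * b m + e m"
        using assms(1) step.hyps mq by simp
      \<comment> \<open>If \<open>r m > 1\<close>, the factor is negative and the induction
        hypothesis cannot be multiplied by it; then the left side is already nonpositive.\<close>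
      also have "(1 - r m) * b m \<le> exp (- r m) * ?E + ?S"
      proof (cases "r m \<le> 1")
        case True
        have "(1 - r m) * b m \<le> (1 - r m) * ?E + (1 - r m) * ?S"
          using step.IH mq True mult_left_mono[of "b m" "?E + ?S" "1 - r m"]
          by (simp add: distrib_left)
        also have "(1 - r m) * ?E \<le> exp (- r m) * ?E"
          using exp_ge_add_one_self[of "- r m"] b by (intro mult_right_mono) auto
        also have "(1 - r m) * ?S \<le> ?S"
          using mult_right_mono[of "1 - r m" 1 ?S] r[of m] step.hyps mq S by simp
        finally show ?thesis by simp
      next
        case False
        then have "(1 - r m) * b m \<le> 0" using b[of m] by (simp add: mult_nonpos_nonneg)
        also have "0 \<le> exp (- r m) * ?E + ?S" using S b[of p] by simp
        finally show ?thesis .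
      qed
      finally show "b (Suc m) \<le> exp (- (\<Sum>j = p..<Suc m. r j)) * b p + (\<Sum>j = p..<Suc m. e j)"
        using step.hyps by (simp add: mult_exp_exp add_ac flip: mult.assoc)
    qed
  qed
  then show ?thesis using assms(5) by blast
qed

text \<open>The value \<open>h\<close> is fixed by the map sending \<open>a\<close> to
  \<open>c * a + (1 - c) * h\<close>, so the excess over \<open>h\<close> shrinks by
  \<open>c\<close> in each step.\<close>

lemma geometric_recursion_bound:
  fixes a :: "nat \<Rightarrow> real"
  assumes step: "\<And>j. p \<le> j \<Longrightarrow> j < q \<Longrightarrow> a (Suc j) \<le> c * a j + (1 - c) * h"
    and c: "0 \<le> c" and h: "0 \<le> h" and "p \<le> q"
  shows "a q \<le> c ^ (q - p) * a p + h"
proof -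
  have "m \<le> q \<longrightarrow> a m \<le> c ^ (m - p) * a p + h" if "p \<le> m" for m
    using that
  proof (induction m rule: dec_induct)
    case base
    then show ?case using h by simp
  next
    case (step m)
    show ?case
    proof
      assume mq: "Suc m \<le> q"
      have "a (Suc m) \<le> c * a m + (1 - c) * h"
        using assms(1) step.hyps mq by simp
      also have "c * a m \<le> c * (c ^ (m - p) * a p + h)"
        using step.IH mq c by (intro mult_left_mono) auto
      finally show "a (Suc m) \<le> c ^ (Suc m - p) * a p + h"
        using step.hyps by (simp add: Suc_diff_le algebra_simps)
    qed
  qed
  then show ?thesis using assms(4) by blast
qed

lemma convex_combination_3:
  assumes "convex S" "u \<in> S" "v \<in> S" "w \<in> S"
    and "0 \<le> a" "0 \<le> b" "0 \<le> c" "a + b + c = 1"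
  shows "a *\<^sub>R u + b *\<^sub>R v + c *\<^sub>R w \<in> S"
  using convex_hull_3 hull_minimal[of "{u, v, w}" S convex] assms by blast

lemma finite_star_set:
  fixes f :: "nat \<Rightarrow> nat"
  assumes "strict_mono f"
  shows "finite {n. f n \<le> k}"
proof (rule finite_subset)
  show "{n. f n \<le> k} \<subseteq> {..k}"
    using strict_mono_imp_increasing[OF assms] order_trans by auto
qed simp

lemma le_star:
  assumes "strict_mono f" "f n \<le> k"
  shows "n \<le> star f k"
  unfolding star_def using assms finite_star_set by (intro Max_ge) auto

text \<open>The bound \<open>f 0 \<le> k\<close> makes the set in \<open>star\<close> nonempty, so
  its maximum is attained.\<close>

lemma f_star_le:
  assumes "strict_mono f" "f 0 \<le> k"
  shows "f (star f k) \<le> k"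
  using Max_in[OF finite_star_set[OF assms(1)], of k] assms(2) unfolding star_def by blast

lemma less_f_Suc_star:
  assumes "strict_mono f"
  shows "k < f (Suc (star f k))"
  using le_star[OF assms, of "Suc (star f k)" k] by (meson Suc_n_not_le_n not_less)

lemma star_mono:
  assumes "strict_mono f" "f 0 \<le> k" "k \<le> k'"
  shows "star f k \<le> star f k'"
  using le_star[OF assms(1)] f_star_le[OF assms(1,2)] assms(3) order_trans by blast

text \<open>For a base below 1 a larger exponent gives a smaller power. A negative logarithm is
  harmless, since \<open>d\<close> is nonnegative anyway.\<close>

lemma power_le_of_ceiling_log_le:
  fixes c t :: real
  assumes "0 < c" "c < 1" "0 < t" "nat \<lceil>log c t\<rceil> \<le> d"
  shows "c ^ d \<le> t"
proof -
  have "log c t \<le> real d" using assms(4) by linarith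
  then have "c powr real d \<le> c powr log c t"
    using assms by (intro powr_mono') auto
  then show ?thesis using assms by (simp add: powr_realpow)
qed

theorem theorem3p5:
  fixes C :: "'a::{real_inner, complete_space} set"
    and T :: "'a \<Rightarrow> 'a"
    and x1 z :: 'a
    and x y :: "nat \<Rightarrow> 'a"
    and M n0 :: nat
    and lam \<theta> :: "nat \<Rightarrow> real"
    and \<phi>1 \<phi>2 \<phi>3 :: "real \<Rightarrow> nat"
    and f :: "nat \<Rightarrow> nat"
    and \<delta> :: real
    and \<Psi> :: "real \<Rightarrow> (nat \<Rightarrow> nat) \<Rightarrow> nat"
  assumes "C \<noteq> {}" and "bounded C" and "closed C" and "convex C"
    and "M > 0" and "diameter C \<le> real M"
    and "T \<in> C \<rightarrow> C" and "demicontinuous_on C T" and "pseudocontraction_on C T"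
    and "x1 \<in> C" and "z \<in> C"
    and "acceptably_paired lam \<theta> \<phi>1 \<phi>2 \<phi>3 f n0 \<delta>"
    and "\<forall>n. lam n * (1 + \<theta> n) \<le> 1"
    and "\<forall>i. y i \<in> C"
    and "\<forall>i. y i = (1 / (1 + \<theta> i)) *\<^sub>R T (y i) + (\<theta> i / (1 + \<theta> i)) *\<^sub>R z"
    and "metastable_with_rate y \<Psi>"
    and "x 1 = x1"
    and "\<forall>n\<ge>1. x (n + 1) = (1 - lam n) *\<^sub>R x n + lam n *\<^sub>R T (x n) + (lam n * \<theta> n) *\<^sub>R (z - x n)"
  shows "\<forall>\<epsilon>>0. \<forall>g :: nat \<Rightarrow> nat. \<exists>n \<le> rate_Phi \<phi>1 \<phi>2 \<phi>3 f n0 \<delta> M \<Psi> \<epsilon> g.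
           1 \<le> n \<and> f 0 \<le> n \<and>
           (\<forall>i\<in>{n..n + g n}. \<forall>j\<in>{n..n + g n}.
              norm (x i - y (f (star f i))) \<le> \<epsilon> \<and>
              norm (y (f (star f i)) - y (f (star f j))) \<le> \<epsilon>)"
proof (intro allI impI)
  fix \<epsilon> :: real and g :: "nat \<Rightarrow> nat"
  assume eps: "\<epsilon> > 0"
  note pair = assms(12)[unfolded acceptably_paired_def]
  have lam: "0 \<le> lam n" "lam n \<le> 1" and th: "0 \<le> \<theta> n" "\<theta> n \<le> 1" for n
    using pair by auto
  have \<delta>: "\<delta> > 0" and dec: "\<And>m n. m \<le> n \<Longrightarrow> \<theta> n \<le> \<theta> m"
    using pair by (auto simp: decseq_def)
  have P1: "\<And>e n. e > 0 \<Longrightarrow> n \<ge> \<phi>1 e \<Longrightarrow> \<theta> n \<le> e"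
    and P3: "\<And>n. n \<ge> n0 \<Longrightarrow> \<theta> (f n) * (\<Sum>j = f n..f (n + 1). lam j) \<ge> \<delta>"
    and P4: "\<And>e n. e > 0 \<Longrightarrow> n \<ge> \<phi>2 e \<Longrightarrow>
      (\<theta> (f n) - \<theta> (f (n + 1))) * (\<Sum>j = f n..f (n + 1). lam j) \<le> e"
    and P5: "\<And>e n. e > 0 \<Longrightarrow> n \<ge> \<phi>3 e \<Longrightarrow> (\<Sum>j = f n..f (n + 1). (lam j)\<^sup>2) \<le> e"
    using pair by blast+
  have "f n < f (Suc n)" for n using pair by (metis Suc_eq_plus1 Suc_le_eq)
  then have f: "strict_mono f" by (simp add: strict_mono_Suc_iff)
  have f_ge: "n \<le> f n" for n by (rule strict_mono_imp_increasing[OF f])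
  have f_mono: "f m \<le> f n" if "m \<le> n" for m n
    using f that by (simp add: strict_mono_less_eq)
  have M: "0 < real M" using assms(5) by simp
  have T: "T u \<in> C" if "u \<in> C" for u using assms(7) that by auto
  have diam: "norm (u - v) \<le> real M" if "u \<in> C" "v \<in> C" for u v
    using diameter_bounded_bound[OF assms(2) that] assms(6) by (simp add: dist_norm)
  have yC: "y i \<in> C" for i using assms(14) by blast
  have fp: "(1 + \<theta> i) *\<^sub>R y i = T (y i) + \<theta> i *\<^sub>R z" for i
  proof -
    have "1 + \<theta> i \<noteq> 0" using th(1)[of i] by linarith
    then have "(1 + \<theta> i) *\<^sub>R ((1 / (1 + \<theta> i)) *\<^sub>R T (y i) + (\<theta> i / (1 + \<theta> i)) *\<^sub>R z) = T (y i) + \<theta> i *\<^sub>R z"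
      by (simp add: scaleR_right_distrib)
    then show ?thesis using assms(15) by metis
  qed
  have rec: "x (Suc n) = (1 - lam n) *\<^sub>R x n + lam n *\<^sub>R T (x n) + (lam n * \<theta> n) *\<^sub>R (z - x n)" if "n \<ge> 1" for n
    using assms(18) that by simp
  \<comment> \<open>The recursion starts at index 1 and \<open>x 0\<close> is arbitrary, hence the
    side condition.\<close>
  have xC: "x n \<in> C" if "n \<ge> 1" for n
    using that
  proof (induction n rule: nat_induct_at_least)
    case base
    then show ?case using assms(10,17) by simp
  next
    case (Suc n)
    \<comment> \<open>Regrouped in this way the coefficients sum to 1, and the first is nonnegative
      because \<open>lam n * (1 + \<theta> n) \<le> 1\<close>.\<close>
    have "x (Suc n) = (1 - lam n * (1 + \<theta> n)) *\<^sub>R x n + (lam n) *\<^sub>R T (x n) + (lam n * \<theta> n) *\<^sub>R z"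
      using rec[OF Suc.hyps] by (simp add: algebra_simps)
    moreover have "\<dots> \<in> C"
      using assms(13) lam[of n] th[of n] Suc.IH T[OF Suc.IH] assms(11)
      by (intro convex_combination_3[OF assms(4)]) (auto simp: algebra_simps)
    ultimately show ?case by simp
  qed

  \<comment> \<open>Distance to \<open>y (f k)\<close> within one block, including its right
    end\<close>
  have block: "(norm (x i - y (f k)))\<^sup>2 \<le>
      exp (- (2 * \<theta> (f k) * (\<Sum>j = f k..<i. lam j))) * (norm (x (f k) - y (f k)))\<^sup>2
      + 2 * (real M)\<^sup>2 * e2 + 4 * (real M)\<^sup>2 * e3"
    if k: "1 \<le> f k" "f k \<le> i" "i \<le> f (Suc k)"
      and e2: "(\<theta> (f k) - \<theta> (f (k + 1))) * (\<Sum>j = f k..f (k + 1). lam j) \<le> e2"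
      and e3: "(\<Sum>j = f k..f (k + 1). (lam j)\<^sup>2) \<le> e3" for i k e2 e3
  proof -
    let ?s = "\<theta> (f k)"
    let ?e = "\<lambda>j. 2 * (real M)\<^sup>2 * (?s - \<theta> j) * lam j + 4 * (real M)\<^sup>2 * (lam j)\<^sup>2"
    have main: "(norm (x i - y (f k)))\<^sup>2 \<le>
       exp (- (\<Sum>j = f k..<i. 2 * lam j * ?s)) * (norm (x (f k) - y (f k)))\<^sup>2 + (\<Sum>j = f k..<i. ?e j)"
    proof (rule contractive_recursion_bound[where b = "\<lambda>j. (norm (x j - y (f k)))\<^sup>2"])
      fix j assume j: "f k \<le> j" "j < i"
      have j1: "1 \<le> j" using j k by simp
      show "(norm (x (Suc j) - y (f k)))\<^sup>2 \<le> (1 - 2 * lam j * ?s) * (norm (x j - y (f k)))\<^sup>2 + ?e j"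
      proof (rule regularized_step_bound[where T = T, OF _ fp rec[OF j1]])
        show "inner (T (x j) - T (y (f k))) (x j - y (f k)) \<le> (norm (x j - y (f k)))\<^sup>2"
          using assms(9) xC[OF j1] yC unfolding pseudocontraction_on_def by blast
      qed (use lam th dec[OF j(1)] diam xC[OF j1] T yC assms(11) in auto)
      show "0 \<le> 2 * lam j * ?s" using lam th by simp
      show "0 \<le> ?e j" using dec[OF j(1)] lam by simp
    qed (use k in auto)
    \<comment> \<open>Each drift is at most the total drop of \<open>\<theta>\<close> over the
      block; the terms are then nonnegative, so the sum may be extended to the closed range used in
      the pairing conditions.\<close>
    have "(\<Sum>j = f k..<i. ?e j) \<le>
      (\<Sum>j = f k..f (k + 1). 2 * (real M)\<^sup>2 * ((?s - \<theta> (f (k + 1))) * lam j) + 4 * (real M)\<^sup>2 * (lam j)\<^sup>2)"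
      (is "_ \<le> sum ?e' _")
    proof -
      have "(\<Sum>j = f k..<i. ?e j) \<le> (\<Sum>j = f k..<i. ?e' j)"
      proof (rule sum_mono)
        fix j assume "j \<in> {f k..<i}"
        then have "\<theta> (f (k + 1)) \<le> \<theta> j" using k by (intro dec) auto
        then have "(?s - \<theta> j) * lam j \<le> (?s - \<theta> (f (k + 1))) * lam j"
          using lam by (intro mult_right_mono) auto
        then have "2 * (real M)\<^sup>2 * ((?s - \<theta> j) * lam j) \<le> 2 * (real M)\<^sup>2 * ((?s - \<theta> (f (k + 1))) * lam j)"
          by (intro mult_left_mono) auto
        then show "?e j \<le> ?e' j" by (simp add: mult.assoc)
      qed
      also have "\<dots> \<le> sum ?e' {f k..f (k + 1)}"
        using k dec[OF f_mono, of k "k + 1"] lam by (intro sum_mono2) auto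
      finally show ?thesis .
    qed
    also have "\<dots> = 2 * (real M)\<^sup>2 * ((?s - \<theta> (f (k + 1))) * (\<Sum>j = f k..f (k + 1). lam j))
        + 4 * (real M)\<^sup>2 * (\<Sum>j = f k..f (k + 1). (lam j)\<^sup>2)"
      by (simp only: sum.distrib sum_distrib_left)
    also have "\<dots> \<le> 2 * (real M)\<^sup>2 * e2 + 4 * (real M)\<^sup>2 * e3"
      using e2 e3 by (intro add_mono mult_left_mono) auto
    finally have "(\<Sum>j = f k..<i. ?e j) \<le> 2 * (real M)\<^sup>2 * e2 + 4 * (real M)\<^sup>2 * e3" .
    moreover have "(\<Sum>j = f k..<i. 2 * lam j * ?s) = 2 * ?s * (\<Sum>j = f k..<i. lam j)"
      by (simp add: sum_distrib_left mult_ac)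
    ultimately show ?thesis using main by simp
  qed

  \<comment> \<open>The constants of the rate\<close>
  define c where "c = exp (- \<delta> / 2)"
  define \<epsilon>' where "\<epsilon>' = (1 - c) / 16 * \<epsilon>"
  define k0 where "k0 = max (\<phi>2 (\<epsilon>\<^sup>2 / (6 * (real M)\<^sup>2))) (\<phi>3 (\<epsilon>\<^sup>2 / (12 * (real M)\<^sup>2)))"
  define d where "d = max (f k0) (nat \<lceil>log c (\<epsilon> / (8 * real M))\<rceil>)"
  define n1 where
    "n1 = Max {n0, \<phi>1 (\<delta> / 2), \<phi>2 (\<epsilon>'\<^sup>2 / (4 * (real M)\<^sup>2)), \<phi>3 (\<epsilon>'\<^sup>2 / (8 * (real M)\<^sup>2))}"
  define g' where "g' = (\<lambda>n. star f (f n + g (f n)) - n)"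
  define gd where "gd = (\<lambda>n. d + n1 + 1 + g' (n + n1 + d + 1))"
  define gdf where "gdf = (\<lambda>n. f (n + gd n) - n)"
  have Phi: "rate_Phi \<phi>1 \<phi>2 \<phi>3 f n0 \<delta> M \<Psi> \<epsilon> g = f (\<Psi> \<epsilon>' gdf + n1 + d + 1)"
    unfolding rate_Phi_def Let_def gdf_def gd_def g'_def n1_def d_def k0_def \<epsilon>'_def c_def ..
  have c: "0 < c" "c < 1" using \<delta> by (auto simp: c_def)
  have eps': "0 < \<epsilon>'" "\<epsilon>' \<le> \<epsilon>"
    using c eps mult_right_mono[of "(1 - c) / 16" 1 \<epsilon>] by (auto simp: \<epsilon>'_def)
  have n1: "n0 \<le> n1" "\<phi>1 (\<delta> / 2) \<le> n1" "\<phi>2 (\<epsilon>'\<^sup>2 / (4 * (real M)\<^sup>2)) \<le> n1"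
      "\<phi>3 (\<epsilon>'\<^sup>2 / (8 * (real M)\<^sup>2)) \<le> n1"
    by (auto simp: n1_def)

  \<comment> \<open>Contraction over a whole block\<close>
  have contract: "norm (x (f (Suc k)) - y (f k)) \<le> c * norm (x (f k) - y (f k)) + \<epsilon>'"
    if k: "1 \<le> k" "n1 \<le> k" for k
  proof -
    let ?a = "norm (x (f k) - y (f k))" and ?S = "\<Sum>j = f k..<f (Suc k). lam j"
    have fk: "1 \<le> f k" "f k \<le> f (Suc k)" using k f_ge[of k] f_mono[of k "Suc k"] by auto
    \<comment> \<open>The thresholds in \<open>n1\<close> are chosen so that each of the two errors
      equals \<open>\<epsilon>'\<^sup>2 / 2\<close>.\<close>
    have "(norm (x (f (Suc k)) - y (f k)))\<^sup>2 \<le> exp (- (2 * \<theta> (f k) * ?S)) * ?a\<^sup>2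
        + 2 * (real M)\<^sup>2 * (\<epsilon>'\<^sup>2 / (4 * (real M)\<^sup>2)) + 4 * (real M)\<^sup>2 * (\<epsilon>'\<^sup>2 / (8 * (real M)\<^sup>2))"
      using fk k n1 eps' M by (intro block P4 P5) auto
    also have "\<dots> = exp (- (2 * \<theta> (f k) * ?S)) * ?a\<^sup>2 + \<epsilon>'\<^sup>2"
      using M by (simp add: field_simps)
    finally have "(norm (x (f (Suc k)) - y (f k)))\<^sup>2 \<le> exp (- (2 * \<theta> (f k) * ?S)) * ?a\<^sup>2 + \<epsilon>'\<^sup>2" .
    moreover have "exp (- (2 * \<theta> (f k) * ?S)) * ?a\<^sup>2 \<le> c\<^sup>2 * ?a\<^sup>2"
    proof (rule mult_right_mono)
      \<comment> \<open>The given sum includes the index \<open>f (k + 1)\<close>, but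
        \<open>?S\<close> does not. The missing term costs at most
        \<open>\<theta> (f k) \<le> \<delta> / 2\<close>, so half of \<open>\<delta>\<close>
        remains; this is why \<open>c\<close> is \<open>exp (- \<delta> / 2)\<close>.\<close>
      have "\<delta> \<le> \<theta> (f k) * (\<Sum>j = f k..f (k + 1). lam j)" using P3 k n1 by simp
      also have "(\<Sum>j = f k..f (k + 1). lam j) = ?S + lam (f (Suc k))"
        using fk by (simp add: sum.last_plus add.commute)
      also have "\<theta> (f k) * (?S + lam (f (Suc k))) \<le> \<theta> (f k) * ?S + \<theta> (f k) * 1"
        using th lam by (simp add: distrib_left mult_left_le)
      finally have "\<delta> \<le> \<theta> (f k) * ?S + \<theta> (f k)" by simp
      moreover have "\<theta> (f k) \<le> \<delta> / 2"
        using P1[of "\<delta> / 2" "f k"] \<delta> n1(2) k f_ge[of k] by simp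
      ultimately have "\<delta> \<le> 2 * \<theta> (f k) * ?S" by simp
      moreover have "c\<^sup>2 = exp (- \<delta>)" by (simp add: c_def power2_eq_square flip: exp_add)
      ultimately show "exp (- (2 * \<theta> (f k) * ?S)) \<le> c\<^sup>2" by simp
    qed simp
    moreover have "c\<^sup>2 * ?a\<^sup>2 + \<epsilon>'\<^sup>2 \<le> (c * ?a + \<epsilon>')\<^sup>2"
      using c eps' by (simp add: power2_sum power_mult_distrib)
    ultimately have "(norm (x (f (Suc k)) - y (f k)))\<^sup>2 \<le> (c * ?a + \<epsilon>')\<^sup>2" by linarith
    then show ?thesis
      by (rule power2_le_imp_le) (use c eps' in simp)
  qed

  \<comment> \<open>A metastable stretch of the \<open>y\<close> sequence\<close>
  obtain N where N: "N \<le> \<Psi> \<epsilon>' gdf"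
    and meta: "\<And>i j. i \<in> {N..N + gdf N} \<Longrightarrow> j \<in> {N..N + gdf N} \<Longrightarrow> norm (y i - y j) \<le> \<epsilon>'"
    using assms(16) eps'(1) unfolding metastable_with_rate_def by meson
  define P where "P = N + n1 + d + 1"
  define Q where "Q = star f (f P + g (f P))"
  have PQ: "P \<le> Q" unfolding Q_def by (rule le_star[OF f]) simp
  \<comment> \<open>\<open>gd\<close> and \<open>gdf\<close> are designed to make the metastable
    interval end exactly at \<open>f Q\<close>, where \<open>Q\<close> is the block of the last
    index \<open>f P + g (f P)\<close>. It then contains \<open>f k\<close> for all \<open>k\<close>
    from \<open>N\<close> to \<open>Q\<close>.\<close>
  have "N + gd N = Q" using PQ unfolding gd_def g'_def Q_def P_def by (simp add: add_ac)
  then have NQ: "N + gdf N = f Q"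
    using f_ge[of Q] PQ unfolding gdf_def P_def by simp
  have close: "norm (y (f k) - y (f l)) \<le> \<epsilon>'" if "N \<le> k" "k \<le> Q" "N \<le> l" "l \<le> Q" for k l
    using that f_mono f_ge[of k] f_ge[of l] by (intro meta) (auto simp: NQ)

  \<comment> \<open>Closeness at block starts\<close>
  have near: "norm (x (f k) - y (f k)) \<le> \<epsilon> / 4" if k: "P \<le> k" "k \<le> Q" for k
  proof -
    let ?a = "\<lambda>k. norm (x (f k) - y (f k))"
    \<comment> \<open>From this block on both \<open>contract\<close> and \<open>close\<close>
      apply, and \<open>P = ?p + d\<close> leaves \<open>d\<close> blocks for the geometric
      decay.\<close>
    let ?p = "N + n1 + 1"
    have "?a k \<le> c ^ (k - ?p) * ?a ?p + \<epsilon> / 8"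
    proof (rule geometric_recursion_bound)
      fix j assume j: "?p \<le> j" "j < k"
      \<comment> \<open>Changing the reference point from \<open>y (f j)\<close> to
        \<open>y (f (Suc j))\<close> costs another \<open>\<epsilon>'\<close>; the factor 16 in
        \<open>\<epsilon>'\<close> gives
        \<open>2 * \<epsilon>' = (1 - c) * (\<epsilon> / 8)\<close>.\<close>
      have "?a (Suc j) \<le> norm (x (f (Suc j)) - y (f j)) + norm (y (f j) - y (f (Suc j)))"
        using norm_triangle_ineq[of "x (f (Suc j)) - y (f j)" "y (f j) - y (f (Suc j))"] by simp
      also have "\<dots> \<le> (c * ?a j + \<epsilon>') + \<epsilon>'"
        using j k by (intro add_mono contract close) auto
      finally show "?a (Suc j) \<le> c * ?a j + (1 - c) * (\<epsilon> / 8)"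
        by (simp add: \<epsilon>'_def field_simps)
    qed (use c eps k P_def in auto)
    \<comment> \<open>The logarithm in \<open>d\<close> is chosen to reduce the initial distance, at
      most \<open>real M\<close>, to \<open>\<epsilon> / 8\<close>.\<close>
    also have "c ^ (k - ?p) * ?a ?p \<le> (\<epsilon> / (8 * real M)) * real M"
    proof (rule mult_mono)
      show "c ^ (k - ?p) \<le> \<epsilon> / (8 * real M)"
      proof (rule power_le_of_ceiling_log_le)
        have "nat \<lceil>log c (\<epsilon> / (8 * real M))\<rceil> \<le> d" by (simp add: d_def)
        also have "d \<le> k - ?p" using k by (simp add: P_def)
        finally show "nat \<lceil>log c (\<epsilon> / (8 * real M))\<rceil> \<le> k - ?p" .
      qed (use c eps M in auto)
      show "?a ?p \<le> real M" using f_ge[of ?p] by (intro diam xC yC) simp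
    qed (use eps in auto)
    finally show ?thesis using M by simp
  qed

  \<comment> \<open>Conclusion with the witness \<open>f P\<close>\<close>
  show "\<exists>n \<le> rate_Phi \<phi>1 \<phi>2 \<phi>3 f n0 \<delta> M \<Psi> \<epsilon> g. 1 \<le> n \<and> f 0 \<le> n \<and>
           (\<forall>i\<in>{n..n + g n}. \<forall>j\<in>{n..n + g n}.
              norm (x i - y (f (star f i))) \<le> \<epsilon> \<and>
              norm (y (f (star f i)) - y (f (star f j))) \<le> \<epsilon>)"
  proof (intro exI[of _ "f P"] conjI ballI)
    show "f P \<le> rate_Phi \<phi>1 \<phi>2 \<phi>3 f n0 \<delta> M \<Psi> \<epsilon> g"
      unfolding Phi P_def using N by (intro f_mono) simp
    show "1 \<le> f P" using f_ge[of P] by (simp add: P_def)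
    show f0: "f 0 \<le> f P" by (rule f_mono) simp
    have star_range: "P \<le> star f i" "star f i \<le> Q" if "i \<in> {f P..f P + g (f P)}" for i
      using that f0 le_star[OF f, of P i] star_mono[OF f, of i "f P + g (f P)"] by (auto simp: Q_def)
    fix i j assume i: "i \<in> {f P..f P + g (f P)}" and j: "j \<in> {f P..f P + g (f P)}"
    show "norm (y (f (star f i)) - y (f (star f j))) \<le> \<epsilon>"
      using close[of "star f i" "star f j"] star_range[OF i] star_range[OF j] eps' by (simp add: P_def)
    define k where "k = star f i"
    have k: "P \<le> k" "k \<le> Q" using star_range[OF i] by (auto simp: k_def)
    \<comment> \<open>This is the purpose of \<open>f k0\<close> in \<open>d\<close>: from
      \<open>k0\<close> on, the errors inside a block are small relative to
      \<open>\<epsilon>\<^sup>2\<close>.\<close>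
    have "k0 \<le> k" using f_ge[of k0] k by (simp add: P_def d_def)
    moreover have "1 \<le> f k" using k f_ge[of k] by (simp add: P_def)
    moreover have "f k \<le> i" "i \<le> f (Suc k)"
      using f_star_le[OF f, of i] less_f_Suc_star[OF f, of i] f0 i by (auto simp: k_def)
    ultimately have "(norm (x i - y (f k)))\<^sup>2 \<le>
      exp (- (2 * \<theta> (f k) * (\<Sum>j = f k..<i. lam j))) * (norm (x (f k) - y (f k)))\<^sup>2
      + 2 * (real M)\<^sup>2 * (\<epsilon>\<^sup>2 / (6 * (real M)\<^sup>2)) + 4 * (real M)\<^sup>2 * (\<epsilon>\<^sup>2 / (12 * (real M)\<^sup>2))"
      using eps M by (intro block P4 P5) (auto simp: k0_def)
    moreover have "exp (- (2 * \<theta> (f k) * (\<Sum>j = f k..<i. lam j))) * (norm (x (f k) - y (f k)))\<^sup>2 \<le> 1 * (\<epsilon> / 4)\<^sup>2"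
    proof (intro mult_mono power_mono near k)
      have "0 \<le> \<theta> (f k) * (\<Sum>j = f k..<i. lam j)"
        by (intro mult_nonneg_nonneg sum_nonneg th lam)
      then show "exp (- (2 * \<theta> (f k) * (\<Sum>j = f k..<i. lam j))) \<le> 1" by simp
    qed auto
    \<comment> \<open>The three terms are 1/16, 1/3 and 1/3 of
      \<open>\<epsilon>\<^sup>2\<close>.\<close>
    moreover have "1 * (\<epsilon> / 4)\<^sup>2 + 2 * (real M)\<^sup>2 * (\<epsilon>\<^sup>2 / (6 * (real M)\<^sup>2))
        + 4 * (real M)\<^sup>2 * (\<epsilon>\<^sup>2 / (12 * (real M)\<^sup>2)) = (35 / 48) * \<epsilon>\<^sup>2"
      using M by (simp add: power2_eq_square field_simps)
    ultimately have "(norm (x i - y (f k)))\<^sup>2 \<le> (35 / 48) * \<epsilon>\<^sup>2" by linarith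
    also have "\<dots> \<le> \<epsilon>\<^sup>2" by simp
    finally show "norm (x i - y (f (star f i))) \<le> \<epsilon>"
      unfolding k_def by (rule power2_le_imp_le) (use eps in simp)
  qed
qed

end
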